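(* Let $P$ be a finite poset. The square faces of $\mathcal{O}(P)$ are exactly the convex hulls of the form \[ \operatorname{conv}(\chi_{F_1\cap F_2},\chi_{F_1},\chi_{F_2},\chi_{F_1\cup F_2}) \] where $F_1$ and $F_2$ are filters of $P$ such that $F_1\setminus F_2$ and $F_2\setminus F_1$ are connected.
   Context: For a finite poset $P$, the order polytope is $\mathcal{O}(P)=\{x\in\mathbb{R}^P: 0\le x_p\le 1 \text{ for all } p\in P,\ x_p\le x_q \text{ whenever } p\le q\}$. A square face is a $2$-dimensional face with exactly four vertices. A filter of $P$ is a subset $F$ with $x\in F,\ y\ge x\Rightarrow y\in F$. For $W\subseteq P$, $\chi_W\in\mathbb{R}^P$ is its characteristic vector. A subset $S\subseteq P$ is connected if it is non-empty and for any $x,y\in S$ there is a sequence $x=p_1,p_2,\dots,p_s=y$ of elements of $S$ with consecutive elements comparable (the empty set is not connected). *)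

theory Defs
  imports "HOL-Analysis.Analysis"
begin

text \<open>
  A finite poset is a subset \<open>P\<close> of a finite ordered type, with the induced order; unlike a bare
  type of class \<^class>\<open>order\<close>, it may be empty.  The space of real vectors indexed by \<open>P\<close> is the
  coordinate subspace of \<^typ>\<open>real ^ 'a\<close> of vectors vanishing outside \<open>P\<close>, which is what
  the first condition below says.
\<close>

definition order_polytope :: "'a set \<Rightarrow> (real ^ ('a::{finite,order})) set" where
  "order_polytope P =
    {x. (\<forall>p. p \<notin> P \<longrightarrow> x $ p = 0) \<and>
        (\<forall>p\<in>P. 0 \<le> x $ p \<and> x $ p \<le> 1) \<and>
        (\<forall>p\<in>P. \<forall>q\<in>P. p \<le> q \<longrightarrow> x $ p \<le> x $ q)}"

text \<open>The polytope itself counts as one of its faces, as in \<^const>\<open>face_of\<close>.\<close>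

definition square_face_of :: "'v::euclidean_space set \<Rightarrow> 'v set \<Rightarrow> bool"
    (infixr \<open>square'_face'_of\<close> 50) where
  "G square_face_of S \<longleftrightarrow>
    G face_of S \<and> aff_dim G = 2 \<and> card {v. v extreme_point_of G} = 4"

definition poset_filter :: "'a::order set \<Rightarrow> 'a set \<Rightarrow> bool" where
  "poset_filter P F \<longleftrightarrow> F \<subseteq> P \<and> (\<forall>x\<in>F. \<forall>y\<in>P. x \<le> y \<longrightarrow> y \<in> F)"

definition char_vec :: "'a set \<Rightarrow> real ^ 'a" where
  "char_vec W = (\<chi> p. indicator W p)"

definition poset_connected :: "'a::order set \<Rightarrow> bool" where
  "poset_connected S \<longleftrightarrow> S \<noteq> {} \<and>
    (\<forall>x\<in>S. \<forall>y\<in>S. \<exists>ps. ps \<noteq> [] \<and> set ps \<subseteq> S \<and> hd ps = x \<and> last ps = y \<and>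
      successively (\<lambda>p q. p \<le> q \<or> q \<le> p) ps)"

end

theory Submission
  imports Defs
begin

text \<open>
  The vertices of a face \<open>G\<close> of the order polytope are the vectors \<open>char_vec F\<close> for the filters
  \<open>F\<close> with \<open>char_vec F \<in> G\<close>.  Since \<open>char_vec F\<^sub>1 + char_vec F\<^sub>2\<close> equals
  \<open>char_vec (F\<^sub>1 \<inter> F\<^sub>2) + char_vec (F\<^sub>1 \<union> F\<^sub>2)\<close>, these filters form a lattice of sets.  A chain of
  filters gives affinely independent vectors, so for a square face the lattice has two incomparable
  elements \<open>F\<^sub>1\<close> and \<open>F\<^sub>2\<close>, and then the four vertices are accounted for.  If \<open>F\<^sub>1 - F\<^sub>2\<close> were the
  union of two nonempty parts with no comparabilities between them, adding one part to
  \<open>F\<^sub>1 \<inter> F\<^sub>2\<close> would give a fifth vertex.  Conversely, requiring \<open>x\<close> to be \<open>1\<close> on \<open>F\<^sub>1 \<inter> F\<^sub>2\<close>, \<open>0\<close>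
  off \<open>F\<^sub>1 \<union> F\<^sub>2\<close> and constant along comparabilities in the two differences cuts out a face.
\<close>

section \<open>Connectedness\<close>

text \<open>A path starting in a set closed under comparability within \<open>S\<close> never leaves
  it; conversely the elements reachable from a given \<open>x\<close> form such a set. This trades
  paths for closed subsets, the form in which both directions use connectedness.\<close>

lemma poset_connected_iff:
  "poset_connected S \<longleftrightarrow> S \<noteq> {} \<and>
    (\<forall>T\<subseteq>S. T \<noteq> {} \<and> (\<forall>p\<in>T. \<forall>q\<in>S. p \<le> q \<or> q \<le> p \<longrightarrow> q \<in> T) \<longrightarrow> T = S)"
  (is "_ \<longleftrightarrow> _ \<and> ?closed")
proof (intro iffI conjI)
  assume conn: "poset_connected S"
  then show "S \<noteq> {}" by (simp add: poset_connected_def)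
  show ?closed
  proof (intro allI impI)
    fix T assume "T \<subseteq> S"
      and T': "T \<noteq> {} \<and> (\<forall>p\<in>T. \<forall>q\<in>S. p \<le> q \<or> q \<le> p \<longrightarrow> q \<in> T)"
    from T' have "T \<noteq> {}" ..
    from T' have T: "\<forall>p\<in>T. \<forall>q\<in>S. p \<le> q \<or> q \<le> p \<longrightarrow> q \<in> T" ..
    have path: "last ps \<in> T"
      if "successively (\<lambda>p q. p \<le> q \<or> q \<le> p) ps" "ps \<noteq> []" "set ps \<subseteq> S" "hd ps \<in> T" for ps
      using that
    proof (induction ps rule: induct_list012)
      case (3 x y zs)
      then have "x \<in> T" "y \<in> S" "x \<le> y \<or> y \<le> x" by simp_all
      then have "y \<in> T" using T by blast
      then show ?case using "3.IH"(2) "3.prems" by simp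
    qed simp_all
    obtain x where "x \<in> T" using \<open>T \<noteq> {}\<close> by auto
    have "y \<in> T" if "y \<in> S" for y
    proof -
      have "x \<in> S" using \<open>x \<in> T\<close> \<open>T \<subseteq> S\<close> by blast
      then obtain ps where "ps \<noteq> []" "set ps \<subseteq> S" "hd ps = x" "last ps = y"
        "successively (\<lambda>p q. p \<le> q \<or> q \<le> p) ps"
        using conn \<open>y \<in> S\<close> unfolding poset_connected_def by blast
      then show ?thesis using path[of ps] \<open>x \<in> T\<close> by simp
    qed
    then show "T = S" using \<open>T \<subseteq> S\<close> by blast
  qed
next
  assume asm: "S \<noteq> {} \<and> ?closed"
  show "poset_connected S"
    unfolding poset_connected_def
  proof (intro conjI ballI)
    show "S \<noteq> {}" using asm by blast
    fix x y assume "x \<in> S" "y \<in> S"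
    define T where "T = {z. \<exists>ps. ps \<noteq> [] \<and> set ps \<subseteq> S \<and> hd ps = x \<and> last ps = z \<and>
      successively (\<lambda>p q. p \<le> q \<or> q \<le> p) ps}"
    have "x \<in> T" unfolding T_def using \<open>x \<in> S\<close> by (intro CollectI exI[of _ "[x]"]) auto
    moreover have "T \<subseteq> S" unfolding T_def by auto
    moreover have "q \<in> T" if "p \<in> T" "q \<in> S" "p \<le> q \<or> q \<le> p" for p q
    proof -
      obtain ps where "ps \<noteq> []" "set ps \<subseteq> S" "hd ps = x" "last ps = p"
        "successively (\<lambda>p q. p \<le> q \<or> q \<le> p) ps"
        using \<open>p \<in> T\<close> unfolding T_def by blast
      then show ?thesis unfolding T_def using that
        by (intro CollectI exI[of _ "ps @ [q]"]) (auto simp: successively_append_iff)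
    qed
    ultimately have "T = S" using asm by blast
    then show "\<exists>ps. ps \<noteq> [] \<and> set ps \<subseteq> S \<and> hd ps = x \<and> last ps = y \<and>
        successively (\<lambda>p q. p \<le> q \<or> q \<le> p) ps"
      using \<open>y \<in> S\<close> unfolding T_def by blast
  qed
qed

section \<open>Characteristic vectors and chains of sets\<close>

lemma char_vec_nth: "char_vec W $ p = (if p \<in> W then 1 else 0)"
  by (simp add: char_vec_def indicator_def)

lemma inj_char_vec: "inj char_vec"
  by (rule injI) (auto simp: vec_eq_iff char_vec_nth split: if_splits)

text \<open>This makes the four sets a parallelogram whose diagonals share their midpoint.\<close>

lemma char_vec_modular:
  "char_vec (A \<inter> B) + char_vec (A \<union> B) = char_vec A + char_vec B"
  by (auto simp: vec_eq_iff char_vec_nth)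

text \<open>In a vanishing combination, let \<open>A\<close> be the least set with nonzero
  coefficient. A coordinate outside \<open>A\<close> but in all the other such sets shows that their
  coefficients sum to 0, and then so does that of \<open>A\<close>. The last step needs the total to
  be 0: the chain may contain the empty set, whose vector is 0, so linear independence can
  fail.\<close>

lemma chain_affine_independent:
  fixes C :: "'a::finite set set"
  assumes chain: "\<And>A B. A \<in> C \<Longrightarrow> B \<in> C \<Longrightarrow> A \<subseteq> B \<or> B \<subseteq> A"
  shows "\<not> affine_dependent (char_vec ` C)"
proof
  assume "affine_dependent (char_vec ` C)"
  then obtain U where U0: "sum U (char_vec ` C) = 0" and ne: "\<exists>v\<in>char_vec ` C. U v \<noteq> 0"
    and U1: "(\<Sum>v\<in>char_vec ` C. U v *\<^sub>R v) = 0"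
    by (auto simp: affine_dependent_explicit_finite)
  have inj: "inj_on char_vec C" by (rule inj_on_subset[OF inj_char_vec subset_UNIV])
  define u where "u A = U (char_vec A)" for A :: "'a set"
  have u0: "sum u C = 0" using U0 by (simp add: sum.reindex[OF inj] u_def o_def)
  have "(\<Sum>A\<in>C. u A *\<^sub>R char_vec A) = 0" using U1 by (simp add: sum.reindex[OF inj] u_def)
  then have "(\<Sum>A\<in>C. u A *\<^sub>R char_vec A) $ p = 0" for p by simp
  then have u1: "(\<Sum>A\<in>C. u A * (char_vec A $ p)) = 0" for p by simp
  define D where "D = {A\<in>C. u A \<noteq> 0}"
  have least: "\<exists>A\<in>E. \<forall>B\<in>E. A \<subseteq> B" if "E \<subseteq> C" "E \<noteq> {}" for E
  proof -
    obtain A where "A \<in> E" "\<forall>B\<in>E. B \<subseteq> A \<longrightarrow> A = B"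
      using finite_has_minimal[OF finite \<open>E \<noteq> {}\<close>] by metis
    then show ?thesis using chain that by blast
  qed
  have "D \<subseteq> C" "D \<noteq> {}" using ne by (auto simp: D_def u_def)
  then obtain A where A: "A \<in> D" "\<And>B. B \<in> D \<Longrightarrow> A \<subseteq> B" using least by meson
  have "(\<Sum>B\<in>D - {A}. u B) = 0"
  proof (cases "D - {A} = {}")
    case False
    moreover have "D - {A} \<subseteq> C" using \<open>D \<subseteq> C\<close> by blast
    ultimately obtain B where B: "B \<in> D - {A}" "\<And>B'. B' \<in> D - {A} \<Longrightarrow> B \<subseteq> B'"
      using least by meson
    then obtain p where p: "p \<in> B" "p \<notin> A" using A(2)[of B] by blast
    \<comment> \<open>As \<open>B\<close> is least in \<open>D - {A}\<close>, the point
      \<open>p\<close> lies in every member of \<open>D\<close> except \<open>A\<close>.\<close>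
    have "(\<Sum>B\<in>D - {A}. u B) = (\<Sum>B\<in>C. u B * (char_vec B $ p))"
      by (rule sum.mono_neutral_cong_left) (use p B in \<open>auto simp: D_def char_vec_nth\<close>)
    then show ?thesis using u1 by simp
  next
    case True
    show ?thesis unfolding True by simp
  qed
  moreover have "sum u D = sum u C" by (rule sum.mono_neutral_left) (auto simp: D_def)
  ultimately have "u A = 0" using u0 sum.remove[of D A u] A(1) by simp
  then show False using A(1) by (simp add: D_def)
qed

lemma chain_aff_dim:
  fixes C :: "'a::finite set set"
  assumes "\<And>A B. A \<in> C \<Longrightarrow> B \<in> C \<Longrightarrow> A \<subseteq> B \<or> B \<subseteq> A"
  shows "aff_dim (char_vec ` C) = int (card C) - 1"
proof -
  have "card (char_vec ` C) = card C"
    by (intro card_image inj_on_subset[OF inj_char_vec subset_UNIV])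
  then show ?thesis
    using aff_dim_affine_independent[OF chain_affine_independent[of C]] assms by simp
qed

section \<open>Faces and convex combinations\<close>

text \<open>The midpoint of \<open>a\<close> and \<open>b\<close> is in \<open>G\<close> by
  convexity and is also the midpoint of \<open>c\<close> and \<open>d\<close>, so the face property
  carries over to these.\<close>

lemma face_of_parallelogram:
  fixes G :: "'v::real_vector set"
  assumes face: "G face_of S" and "a \<in> G" "b \<in> G" and "c \<in> S" "d \<in> S" and eq: "c + d = a + b"
  shows "c \<in> G"
proof -
  have "midpoint a b \<in> G"
    using face_of_imp_convex[OF face] \<open>a \<in> G\<close> \<open>b \<in> G\<close> midpoint_in_closed_segment[of a b]
    unfolding convex_contains_segment by blast
  then have mid: "midpoint c d \<in> G" using eq by (simp add: midpoint_def)
  show ?thesis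
  proof (cases "c = d")
    \<comment> \<open>The open segment is empty here, but the midpoint is \<open>c\<close>
      itself.\<close>
    case True
    then show ?thesis using mid by simp
  next
    case False
    then have "midpoint c d \<in> open_segment c d" by simp
    then show ?thesis using face_ofD[OF face] mid assms by blast
  qed
qed

text \<open>Two nonnegative gaps with positive weights sum to 0. Applied coordinatewise, this says
  that an inequality tight inside a segment is tight at both ends.\<close>

lemma convex_combination_eq_imp:
  fixes a b c d u :: real
  assumes "0 < u" "u < 1" "a \<le> c" "b \<le> d" "(1 - u) * a + u * b = (1 - u) * c + u * d"
  shows "a = c \<and> b = d"
proof -
  have "(1 - u) * (c - a) + u * (d - b) = 0" using assms by (simp add: algebra_simps)
  then show ?thesis using assms by (subst (asm) add_nonneg_eq_0_iff) auto
qed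

section \<open>The order polytope and its vertices\<close>

lemma convex_order_polytope:
  fixes P :: "'a::{finite,order} set"
  shows "convex (order_polytope P)"
proof (rule convexI)
  fix x y and u v :: real
  assume "x \<in> order_polytope P" "y \<in> order_polytope P" "0 \<le> u" "0 \<le> v" "u + v = 1"
  then show "u *\<^sub>R x + v *\<^sub>R y \<in> order_polytope P"
    by (auto simp: order_polytope_def intro!: add_mono mult_left_mono convex_bound_le)
qed

lemma compact_order_polytope: "compact (order_polytope P)"
proof -
  have "order_polytope P \<subseteq> cbox 0 1"
  proof
    fix x assume x: "x \<in> order_polytope P"
    have "0 \<le> x $ p \<and> x $ p \<le> 1" for p
      using x by (cases "p \<in> P") (auto simp: order_polytope_def)
    then show "x \<in> cbox 0 1" by (simp add: mem_box_cart)
  qed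
  then have "bounded (order_polytope P)" using bounded_cbox bounded_subset by blast
  moreover have "closed (order_polytope P)"
    unfolding order_polytope_def Ball_def
    by (intro closed_Collect_conj closed_Collect_all closed_Collect_imp closed_Collect_eq
        closed_Collect_le open_Collect_const continuous_intros)
  ultimately show ?thesis by (simp add: compact_eq_bounded_closed)
qed

lemma char_vec_in_order_polytope:
  "poset_filter P F \<Longrightarrow> char_vec F \<in> order_polytope P"
  by (auto simp: poset_filter_def order_polytope_def char_vec_nth)

lemma char_vec_in_order_polytope_iff:
  "char_vec F \<in> order_polytope P \<longleftrightarrow> poset_filter P F"
proof
  assume "char_vec F \<in> order_polytope P"
  then have 0: "\<And>p. p \<notin> P \<Longrightarrow> p \<notin> F"
    and mono: "\<And>p q. p \<in> P \<Longrightarrow> q \<in> P \<Longrightarrow> p \<le> q \<Longrightarrow> char_vec F $ p \<le> char_vec F $ q"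
    by (auto simp: order_polytope_def char_vec_nth split: if_splits)
  have "q \<in> F" if "p \<in> F" "q \<in> P" "p \<le> q" for p q
    using mono[of p q] 0[of p] that by (cases "q \<in> F") (auto simp: char_vec_nth)
  then show "poset_filter P F" using 0 by (auto simp: poset_filter_def)
qed (rule char_vec_in_order_polytope)

text \<open>If \<open>x\<close> lies in the order polytope then so do \<open>x\<^sup>2\<close> and \<open>2x - x\<^sup>2\<close> (taken coordinatewise),
  whose midpoint is \<open>x\<close>; they differ unless all coordinates are \<open>0\<close> or \<open>1\<close>.\<close>

lemma extreme_point_of_order_polytope:
  "x extreme_point_of order_polytope P \<longleftrightarrow> (\<exists>F. poset_filter P F \<and> x = char_vec F)"
proof
  assume ext: "x extreme_point_of order_polytope P"
  then have x: "x \<in> order_polytope P" by (simp add: extreme_point_of_def)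
  define y where "y = (\<chi> p. x $ p * x $ p)"
  define z where "z = (\<chi> p. 1 - (1 - x $ p) * (1 - x $ p))"
  have "y \<in> order_polytope P"
    using x by (auto simp: order_polytope_def y_def mult_le_one intro!: mult_mono)
  moreover have "z \<in> order_polytope P"
    using x by (auto simp: order_polytope_def z_def mult_le_one intro!: mult_mono)
  moreover have "x = midpoint y z"
    by (simp add: vec_eq_iff midpoint_def y_def z_def algebra_simps)
  ultimately have "y = z"
    using ext unfolding extreme_point_of_def by (metis midpoint_in_open_segment)
  have "x $ p = 0 \<or> x $ p = 1" for p
  proof -
    have "y $ p = z $ p" using \<open>y = z\<close> by simp
    then have "x $ p * (1 - x $ p) = 0" by (simp add: y_def z_def algebra_simps)
    then show ?thesis by simp
  qed
  then have "x = char_vec {p. x $ p = 1}" by (auto simp: vec_eq_iff char_vec_nth)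
  then show "\<exists>F. poset_filter P F \<and> x = char_vec F"
    using x char_vec_in_order_polytope_iff by metis
next
  assume "\<exists>F. poset_filter P F \<and> x = char_vec F"
  then obtain F where F: "poset_filter P F" and x: "x = char_vec F" by blast
  have "x \<notin> open_segment a b" if ab: "a \<in> order_polytope P" "b \<in> order_polytope P" for a b
  proof
    assume "x \<in> open_segment a b"
    then obtain u where u: "0 < u" "u < 1" and xu: "x = (1 - u) *\<^sub>R a + u *\<^sub>R b" and "a \<noteq> b"
      by (auto simp: in_segment)
    \<comment> \<open>Each coordinate of \<open>x\<close> is 0 or 1, an end of the range allowed for
      \<open>a $ p\<close> and \<open>b $ p\<close>, so both must equal it.\<close>
    have "a $ p = b $ p" for p
    proof -
      have bounds: "0 \<le> a $ p" "a $ p \<le> 1" "0 \<le> b $ p" "b $ p \<le> 1"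
        using ab unfolding order_polytope_def by (cases "p \<in> P"; force)+
      have eq: "(1 - u) * a $ p + u * b $ p = char_vec F $ p"
        using xu unfolding x by simp
      show ?thesis
      proof (cases "p \<in> F")
        case True
        then show ?thesis
          using convex_combination_eq_imp[OF u, of "a $ p" 1 "b $ p" 1] bounds eq
          by (simp add: char_vec_nth)
      next
        case False
        then show ?thesis
          using convex_combination_eq_imp[OF u, of 0 "a $ p" 0 "b $ p"] bounds eq
          by (simp add: char_vec_nth)
      qed
    qed
    then show False using \<open>a \<noteq> b\<close> by (simp add: vec_eq_iff)
  qed
  then show "x extreme_point_of order_polytope P"
    using char_vec_in_order_polytope[OF F] x by (auto simp: extreme_point_of_def)
qed

section \<open>The filters of a face\<close>

text \<open>The vertices of the face \<open>G\<close>, recorded as sets so that inclusion,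
  intersection and union apply to them.\<close>

definition face_filters :: "'a set \<Rightarrow> (real ^ 'a::{finite,order}) set \<Rightarrow> 'a set set" where
  "face_filters P G = {F. poset_filter P F \<and> char_vec F \<in> G}"

lemma extreme_points_of_face:
  assumes "G face_of order_polytope P"
  shows "{v. v extreme_point_of G} = char_vec ` face_filters P G"
  unfolding extreme_point_of_face[OF assms] extreme_point_of_order_polytope
  by (auto simp: face_filters_def)

text \<open>A face of a compact convex set is compact and convex, hence the hull of its extreme
  points.\<close>

lemma face_eq_convex_hull:
  assumes "G face_of order_polytope P"
  shows "G = convex hull (char_vec ` face_filters P G)"
proof -
  have "compact G" "convex G"
    using face_of_imp_compact face_of_imp_convex assms convex_order_polytope
      compact_order_polytope by blast+
  then show ?thesis
    using Krein_Milman_Minkowski extreme_points_of_face[OF assms] by metis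
qed

text \<open>Passing to the convex hull keeps the affine dimension, and \<open>char_vec\<close> is
  injective, so squareness can be read off the filters.\<close>

lemma square_face_iff:
  "G square_face_of order_polytope P \<longleftrightarrow>
    G face_of order_polytope P \<and> aff_dim (char_vec ` face_filters P G) = 2 \<and>
    card (face_filters P G) = 4"
proof -
  have "card (char_vec ` face_filters P G) = card (face_filters P G)"
    by (intro card_image inj_on_subset[OF inj_char_vec subset_UNIV])
  moreover have "aff_dim G = aff_dim (char_vec ` face_filters P G)"
    if "G face_of order_polytope P"
    using face_eq_convex_hull[OF that] aff_dim_convex_hull by metis
  ultimately show ?thesis
    unfolding square_face_of_def by (auto simp: extreme_points_of_face)
qed

lemma poset_filter_Int: "poset_filter P A \<Longrightarrow> poset_filter P B \<Longrightarrow> poset_filter P (A \<inter> B)"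
  and poset_filter_Un: "poset_filter P A \<Longrightarrow> poset_filter P B \<Longrightarrow> poset_filter P (A \<union> B)"
  by (auto simp: poset_filter_def)

text \<open>The parallelogram argument works along either diagonal. One direction gives a lattice of
  sets; the other puts new filters into the face when a known one is split.\<close>

lemma face_filters_Int_Un:
  assumes face: "G face_of order_polytope P"
    and A: "poset_filter P A" and B: "poset_filter P B"
  shows "A \<in> face_filters P G \<and> B \<in> face_filters P G \<longleftrightarrow>
    A \<inter> B \<in> face_filters P G \<and> A \<union> B \<in> face_filters P G"
proof -
  note poly = char_vec_in_order_polytope[OF A] char_vec_in_order_polytope[OF B]
    char_vec_in_order_polytope[OF poset_filter_Int[OF A B]]
    char_vec_in_order_polytope[OF poset_filter_Un[OF A B]]
  note eq = char_vec_modular[of A B]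
  have eq': "char_vec (A \<union> B) + char_vec (A \<inter> B) = char_vec A + char_vec B"
    "char_vec B + char_vec A = char_vec (A \<inter> B) + char_vec (A \<union> B)"
    using eq by (simp_all add: add.commute)
  have "char_vec A \<in> G \<and> char_vec B \<in> G \<longleftrightarrow> char_vec (A \<inter> B) \<in> G \<and> char_vec (A \<union> B) \<in> G"
    using face_of_parallelogram[OF face _ _ poly(3,4) eq]
      face_of_parallelogram[OF face _ _ poly(4,3) eq'(1)]
      face_of_parallelogram[OF face _ _ poly(1,2) eq[symmetric]]
      face_of_parallelogram[OF face _ _ poly(2,1) eq'(2)]
    by blast
  then show ?thesis
    using A B poset_filter_Int[OF A B] poset_filter_Un[OF A B] by (simp add: face_filters_def)
qed

lemma card_four_incomparable:
  assumes "\<not> A \<subseteq> B" "\<not> B \<subseteq> A"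
  shows "card {A \<inter> B, A, B, A \<union> B} = 4"
proof -
  have "A \<inter> B \<noteq> A" "A \<inter> B \<noteq> B" "A \<inter> B \<noteq> A \<union> B" "A \<noteq> B" "A \<noteq> A \<union> B" "B \<noteq> A \<union> B"
    using assms by blast+
  then show ?thesis by simp
qed

lemma face_filters_diff_connected:
  assumes face: "G face_of order_polytope P"
    and F1: "poset_filter P F1" and F2: "poset_filter P F2"
    and L: "face_filters P G = {F1 \<inter> F2, F1, F2, F1 \<union> F2}"
    and ne: "\<not> F1 \<subseteq> F2"
  shows "poset_connected (F1 - F2)"
  unfolding poset_connected_iff
proof (intro conjI allI impI)
  show "F1 - F2 \<noteq> {}" using ne by blast
  fix T assume "T \<subseteq> F1 - F2"
    and T': "T \<noteq> {} \<and> (\<forall>p\<in>T. \<forall>q\<in>F1 - F2. p \<le> q \<or> q \<le> p \<longrightarrow> q \<in> T)"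
  from T' have "T \<noteq> {}" ..
  from T' have T: "\<And>p q. p \<in> T \<Longrightarrow> q \<in> F1 - F2 \<Longrightarrow> p \<le> q \<or> q \<le> p \<Longrightarrow> q \<in> T" by metis
  have sub: "F1 \<subseteq> P" and up1: "\<And>p q. p \<in> F1 \<Longrightarrow> q \<in> P \<Longrightarrow> p \<le> q \<Longrightarrow> q \<in> F1"
    and up2: "\<And>p q. p \<in> F2 \<Longrightarrow> q \<in> P \<Longrightarrow> p \<le> q \<Longrightarrow> q \<in> F2"
    using F1 F2 by (auto simp: poset_filter_def)
  define A where "A = (F1 \<inter> F2) \<union> T"
  define B where "B = (F1 \<inter> F2) \<union> (F1 - F2 - T)"
  have "poset_filter P A"
    unfolding poset_filter_def
  proof (intro conjI ballI impI)
    show "A \<subseteq> P" using sub \<open>T \<subseteq> F1 - F2\<close> by (auto simp: A_def)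
    fix p q assume pq: "p \<in> A" "q \<in> P" "p \<le> q"
    then have "q \<in> F1" using up1[of p q] \<open>T \<subseteq> F1 - F2\<close> by (auto simp: A_def)
    \<comment> \<open>If \<open>p\<close> is in \<open>T\<close>, then \<open>q\<close> is in
      \<open>F2\<close> or is an element of \<open>F1 - F2\<close> comparable to \<open>p\<close>,
      hence in \<open>T\<close>.\<close>
    then show "q \<in> A" using pq up2[of p q] T[of p q] by (auto simp: A_def)
  qed
  moreover have "poset_filter P B"
    unfolding poset_filter_def
  proof (intro conjI ballI impI)
    show "B \<subseteq> P" using sub by (auto simp: B_def)
    fix p q assume pq: "p \<in> B" "q \<in> P" "p \<le> q"
    then have "q \<in> F1" using up1[of p q] by (auto simp: B_def)
    \<comment> \<open>Closure of \<open>T\<close> is used downwards: \<open>q\<close> in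
      \<open>T\<close> would force \<open>p\<close> into \<open>T\<close>.\<close>
    then show "q \<in> B" using pq up2[of p q] T[of q p] by (auto simp: B_def)
  qed
  moreover have "A \<inter> B = F1 \<inter> F2" "A \<union> B = F1"
    using \<open>T \<subseteq> F1 - F2\<close> by (auto simp: A_def B_def)
  \<comment> \<open>The filters \<open>A\<close> and \<open>B\<close> form the other diagonal of a
    parallelogram with \<open>F1 \<inter> F2\<close> and \<open>F1\<close>.\<close>
  ultimately have "A \<in> face_filters P G"
    using face_filters_Int_Un[OF face] L by (metis insertCI)
  then have "A = F1 \<inter> F2 \<or> A = F1 \<or> A = F2 \<or> A = F1 \<union> F2" using L by simp
  then show "T = F1 - F2"
    using \<open>T \<noteq> {}\<close> \<open>T \<subseteq> F1 - F2\<close> unfolding A_def by blast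
qed

lemma square_face_obtains:
  assumes "G square_face_of order_polytope P"
  obtains F1 F2 where "poset_filter P F1" "poset_filter P F2"
    "poset_connected (F1 - F2)" "poset_connected (F2 - F1)"
    "G = convex hull (char_vec ` {F1 \<inter> F2, F1, F2, F1 \<union> F2})"
proof -
  have face: "G face_of order_polytope P"
    and dim: "aff_dim (char_vec ` face_filters P G) = 2"
    and card: "card (face_filters P G) = 4"
    using assms by (auto simp: square_face_iff)
  \<comment> \<open>A chain of four filters would have affine dimension 3.\<close>
  obtain F1 F2 where L: "F1 \<in> face_filters P G" "F2 \<in> face_filters P G"
    and inc: "\<not> F1 \<subseteq> F2" "\<not> F2 \<subseteq> F1"
    using chain_aff_dim[of "face_filters P G"] dim card by fastforce
  have fil: "poset_filter P F1" "poset_filter P F2" using L by (auto simp: face_filters_def)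
  have "{F1 \<inter> F2, F1, F2, F1 \<union> F2} \<subseteq> face_filters P G"
    using L face_filters_Int_Un[OF face fil] by blast
  then have eq: "face_filters P G = {F1 \<inter> F2, F1, F2, F1 \<union> F2}"
    using card card_four_incomparable[OF inc]
    by (metis card_subset_eq finite_code)
  \<comment> \<open>The swapped form gives connectedness of \<open>F2 - F1\<close> by
    symmetry.\<close>
  then have eq': "face_filters P G = {F2 \<inter> F1, F2, F1, F2 \<union> F1}" by auto
  show ?thesis
  proof
    show "G = convex hull (char_vec ` {F1 \<inter> F2, F1, F2, F1 \<union> F2})"
      using face_eq_convex_hull[OF face] unfolding eq .
  qed (use fil face_filters_diff_connected[OF face] eq eq' inc in auto)
qed

section \<open>Square faces from connected differences\<close>

text \<open>Every condition turns an inequality valid on the polytope into an equality, and such an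
  equality passes from an inner point of a segment to its ends. \<open>B\<close> may reach outside
  \<open>P\<close>, where all coordinates vanish.\<close>

lemma face_of_order_polytope:
  fixes P :: "'a::{finite,order} set"
  assumes R: "\<And>p q. (p, q) \<in> R \<Longrightarrow> p \<in> P \<and> q \<in> P \<and> p \<le> q"
  shows "{x \<in> order_polytope P. (\<forall>p\<in>A \<inter> P. x $ p = 1) \<and> (\<forall>p\<in>B. x $ p = 0) \<and>
      (\<forall>p q. (p, q) \<in> R \<longrightarrow> x $ p = x $ q)} face_of order_polytope P" (is "?K face_of _")
  unfolding face_of_def
proof (intro conjI ballI impI)
  show "?K \<subseteq> order_polytope P" by blast
  show "convex ?K"
  proof (rule convexI)
    fix x y and u v :: real
    assume xy: "x \<in> ?K" "y \<in> ?K" and uv: "0 \<le> u" "0 \<le> v" "u + v = 1"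
    then have "u *\<^sub>R x + v *\<^sub>R y \<in> order_polytope P"
      using convexD[OF convex_order_polytope, of x P y u v] by simp
    then show "u *\<^sub>R x + v *\<^sub>R y \<in> ?K" using xy uv by simp
  qed
  fix a b x
  assume a: "a \<in> order_polytope P" and b: "b \<in> order_polytope P" and x: "x \<in> ?K"
    and seg: "x \<in> open_segment a b"
  obtain u where u: "0 < u" "u < 1" and xu: "x = (1 - u) *\<^sub>R a + u *\<^sub>R b"
    using seg by (auto simp: in_segment)
  have xp: "x $ p = (1 - u) * a $ p + u * b $ p" for p by (simp add: xu)
  have one: "a $ p = 1 \<and> b $ p = 1" if "p \<in> A \<inter> P" for p
  proof (rule convex_combination_eq_imp[OF u])
    show "a $ p \<le> 1" "b $ p \<le> 1" using a b that by (auto simp: order_polytope_def)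
    show "(1 - u) * a $ p + u * b $ p = (1 - u) * 1 + u * 1"
      using x that xp[of p] by auto
  qed
  have zero: "0 = a $ p \<and> 0 = b $ p" if "p \<in> B" for p
  proof (rule convex_combination_eq_imp[OF u])
    show "0 \<le> a $ p" "0 \<le> b $ p"
      using a b by (cases "p \<in> P"; auto simp: order_polytope_def)+
    show "(1 - u) * 0 + u * 0 = (1 - u) * a $ p + u * b $ p"
      using x that xp[of p] by auto
  qed
  have eq: "a $ p = a $ q \<and> b $ p = b $ q" if "(p, q) \<in> R" for p q
  proof (rule convex_combination_eq_imp[OF u])
    show "a $ p \<le> a $ q" "b $ p \<le> b $ q"
      using a b R[OF that] by (auto simp: order_polytope_def)
    show "(1 - u) * a $ p + u * b $ p = (1 - u) * a $ q + u * b $ q"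
      using x that xp[of p] xp[of q] by auto
  qed
  show "a \<in> ?K" "b \<in> ?K" using a b one zero eq by simp_all
qed

text \<open>\<open>F \<inter> S\<close> is closed under comparability within
  \<open>S\<close>.\<close>

lemma poset_connected_constant_subset:
  assumes "poset_connected S"
    and "\<And>p q. p \<in> S \<Longrightarrow> q \<in> S \<Longrightarrow> p \<le> q \<Longrightarrow> p \<in> F \<longleftrightarrow> q \<in> F"
  shows "F \<inter> S = {} \<or> S \<subseteq> F"
proof -
  have "\<forall>p\<in>F \<inter> S. \<forall>q\<in>S. p \<le> q \<or> q \<le> p \<longrightarrow> q \<in> F \<inter> S" using assms(2) by blast
  then show ?thesis using assms(1) unfolding poset_connected_iff
    by (metis Int_lower1 Int_lower2)
qed

lemma square_face_of_connected:
  assumes F1: "poset_filter P F1" and F2: "poset_filter P F2"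
    and conn1: "poset_connected (F1 - F2)" and conn2: "poset_connected (F2 - F1)"
  shows "convex hull (char_vec ` {F1 \<inter> F2, F1, F2, F1 \<union> F2}) square_face_of order_polytope P"
proof -
  let ?C = "{F1 \<inter> F2, F1, F2, F1 \<union> F2}"
  \<comment> \<open>Only pairs within one difference are related, so the values on the two
    differences stay independent of each other.\<close>
  define R where "R = {(p, q). p \<le> q \<and>
    (p \<in> F1 - F2 \<and> q \<in> F1 - F2 \<or> p \<in> F2 - F1 \<and> q \<in> F2 - F1)}"
  define K where "K = {x \<in> order_polytope P. (\<forall>p\<in>F1 \<inter> F2 \<inter> P. x $ p = 1) \<and>
    (\<forall>p\<in>- (F1 \<union> F2). x $ p = 0) \<and> (\<forall>p q. (p, q) \<in> R \<longrightarrow> x $ p = x $ q)}"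
  have sub: "F1 \<subseteq> P" "F2 \<subseteq> P" using F1 F2 by (auto simp: poset_filter_def)
  have face: "K face_of order_polytope P"
    unfolding K_def by (rule face_of_order_polytope) (use sub in \<open>auto simp: R_def\<close>)
  have "F \<in> face_filters P K \<longleftrightarrow> F \<in> ?C" for F
  proof
    assume "F \<in> face_filters P K"
    then have F: "char_vec F \<in> K" by (simp add: face_filters_def)
    have lo: "F1 \<inter> F2 \<subseteq> F" and hi: "F \<subseteq> F1 \<union> F2"
      using F sub by (fastforce simp: K_def char_vec_nth split: if_splits)+
    have eq: "p \<in> F \<longleftrightarrow> q \<in> F" if "(p, q) \<in> R" for p q
    proof -
      have "char_vec F $ p = char_vec F $ q" using F that by (auto simp: K_def)
      then show ?thesis by (simp add: char_vec_nth split: if_splits)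
    qed
    have "F \<inter> (F1 - F2) = {} \<or> F1 - F2 \<subseteq> F"
      by (rule poset_connected_constant_subset[OF conn1], rule eq) (simp add: R_def)
    moreover have "F \<inter> (F2 - F1) = {} \<or> F2 - F1 \<subseteq> F"
      by (rule poset_connected_constant_subset[OF conn2], rule eq) (simp add: R_def)
    \<comment> \<open>\<open>F\<close> contains all or nothing of each difference, which leaves four
      choices.\<close>
    ultimately have "F = F1 \<inter> F2 \<or> F = F1 \<or> F = F2 \<or> F = F1 \<union> F2"
      using lo hi by blast
    then show "F \<in> ?C" by simp
  next
    assume F: "F \<in> ?C"
    then have fil: "poset_filter P F" using F1 F2 poset_filter_Int poset_filter_Un by blast
    then have "char_vec F \<in> K"
      using F char_vec_in_order_polytope[OF fil] by (auto simp: K_def R_def char_vec_nth)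
    then show "F \<in> face_filters P K" using fil by (simp add: face_filters_def)
  qed
  then have L: "face_filters P K = ?C" by blast
  have inc: "\<not> F1 \<subseteq> F2" "\<not> F2 \<subseteq> F1"
    using conn1 conn2 by (auto simp: poset_connected_def)
  have "aff_dim (char_vec ` ?C) = 2"
  proof -
    \<comment> \<open>The coefficients sum to 1, so \<open>char_vec F2\<close> adds no dimension to
      the other three vectors, which come from a chain.\<close>
    have "char_vec F2 = 1 *\<^sub>R char_vec (F1 \<inter> F2) + (- 1) *\<^sub>R char_vec F1 + 1 *\<^sub>R char_vec (F1 \<union> F2)"
      using char_vec_modular[of F1 F2] by (simp add: algebra_simps)
    then have "char_vec F2 \<in> affine hull {char_vec (F1 \<inter> F2), char_vec F1, char_vec (F1 \<union> F2)}"
      unfolding affine_hull_3 by (intro CollectI exI conjI) (assumption | simp)+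
    then have "char_vec F2 \<in> affine hull (char_vec ` {F1 \<inter> F2, F1, F1 \<union> F2})" by simp
    moreover have "char_vec ` ?C = insert (char_vec F2) (char_vec ` {F1 \<inter> F2, F1, F1 \<union> F2})"
      by auto
    ultimately have "aff_dim (char_vec ` ?C) = aff_dim (char_vec ` {F1 \<inter> F2, F1, F1 \<union> F2})"
      by (simp only: aff_dim_insert if_True)
    also have "\<dots> = int (card {F1 \<inter> F2, F1, F1 \<union> F2}) - 1"
      by (rule chain_aff_dim) auto
    also have "card {F1 \<inter> F2, F1, F1 \<union> F2} = 3"
    proof -
      have "F1 \<inter> F2 \<noteq> F1" "F1 \<inter> F2 \<noteq> F1 \<union> F2" "F1 \<noteq> F1 \<union> F2" using inc by blast+
      then show ?thesis by simp
    qed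
    finally show ?thesis by simp
  qed
  then have "K square_face_of order_polytope P"
    unfolding square_face_iff L using face card_four_incomparable[OF inc] by blast
  then show ?thesis using face_eq_convex_hull[OF face] unfolding L by simp
qed

theorem theorem5p2:
  fixes P :: "'a::{finite,order} set"
  shows "{G. G square_face_of order_polytope P} =
    {convex hull {char_vec (F1 \<inter> F2), char_vec F1, char_vec F2, char_vec (F1 \<union> F2)} | F1 F2.
      poset_filter P F1 \<and> poset_filter P F2 \<and>
      poset_connected (F1 - F2) \<and> poset_connected (F2 - F1)}" (is "?L = ?R")
proof
  show "?L \<subseteq> ?R"
  proof
    fix G assume "G \<in> ?L"
    then have "G square_face_of order_polytope P" by simp
    then obtain F1 F2 where "poset_filter P F1" "poset_filter P F2"
      "poset_connected (F1 - F2)" "poset_connected (F2 - F1)"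
      "G = convex hull (char_vec ` {F1 \<inter> F2, F1, F2, F1 \<union> F2})"
      by (rule square_face_obtains)
    then show "G \<in> ?R" by auto
  qed
  show "?R \<subseteq> ?L" using square_face_of_connected by fastforce
qed

end
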